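(* Let $f:\mathbb{R}^d\to\mathbb{R}$ be convex with nonempty set of minimizers. Suppose the first-order method $\mathtt{fom}(\epsilon)$ satisfies the decrement guarantee with a function $K_{\mathtt{dec}}$, and $f$ satisfies the growth condition with a function $G$ (both defined in the context). Let $\{\epsilon_k\}_{k\ge 0}$ be any strictly increasing sequence of positive reals with $\epsilon_k\to\infty$, let $N_0\ge 1$ be an integer, let $\Delta_0=f(x^{(0)})-f_\star$, and let $$m=\inf\{k:\epsilon_k\ge \Delta_0/2\},\qquad \hat m=\inf\{k:\epsilon_k>\Delta_0\},$$ $$Q_k(\delta_{\min},\delta_{\max})=\sup_{\delta\in[\delta_{\min},\delta_{\max}]}K_{\mathtt{dec}}\left(\epsilon_k,\delta,G^{-1}(\delta)\right).$$ Then the Dynamic Restarting Scheme (described in the context), run from $x^{(0)}$ with targets $\{\epsilon_k\}$ and initial process count $N_0$, computes a $(2\epsilon_0)$-optimal solution no later than round $$\max_{N_0\le s\le m}\ \sum_{k=N_0-1}^{s-1}Q_k\Big(\epsilon_{s-1}+\sum_{j=k}^{s-1}\epsilon_j,\ \Delta_0-\sum_{j=N_0-1}^{k-1}\epsilon_j\Big)\;+\;\sum_{k=0}^{m-1}\ \max_{1\le r<\frac{2\epsilon_{k+1}}{\epsilon_k}}\ \sum_{i=0}^{r-1}Q_k\Big((r+1-i)\epsilon_k,\ \min\{2\epsilon_{k+1}+(1-i)\epsilon_k,\ \Delta_0\}\Big),$$ where $s,r$ range over integers, and at most $\max\{\hat m+1,N_0\}$ processes are launched.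
   Context: Notation: $f_\star=\min f$, $X_\star=\operatorname{argmin} f\neq\emptyset$, $\operatorname{dist}(y,X_\star)=\inf_{x\in X_\star}\|y-x\|_2$. A maximum, supremum or sum over an empty set is $0$. A point $x$ is $\eta$-optimal if $f(x)-f_\star\le\eta$; "computes an $\eta$-optimal solution no later than round $T$" means that for some integer $0\le t\le T$ the point $\overline x^{(t)}$ defined below is $\eta$-optimal. First-order method. $\mathtt{fom}(\epsilon)$, $\epsilon>0$, is a deterministic iterative method which from any initial point $x^{(0)}$ generates iterates $x^{(1)},x^{(2)},\dots$ sequentially. Decrement guarantee. There is a non-negative finite-valued function $K_{\mathtt{dec}}(\epsilon,\delta,D)$ such that for all $\delta\ge 2\epsilon>0$, $D>0$ and every initial point $x^{(0)}$ with $f(x^{(0)})-f_\star\ge\delta$ and $\operatorname{dist}(x^{(0)},X_\star)\le D$, the iterates of $\mathtt{fom}(\epsilon)$ satisfy $\min\{f(x^{(k)}):0\le k\le K_{\mathtt{dec}}(\epsilon,\delta,D)\}\le f(x^{(0)})-\epsilon$. As a standing convention (without loss of generality), $K_{\mathtt{dec}}$ is nonincreasing in $\delta$ and nondecreasing in $D$. Growth condition. There is a strictly increasing invertible $G:[0,\infty)\to[0,\infty)$ with $f(x)-f_\star\ge G(\operatorname{dist}(x,X_\star))$ for all $x$ with $f(x)\le f(x^{(0)})$, where $x^{(0)}$ is the initialization of the scheme. Dynamic Restarting Scheme. Input: $x^{(0)}$, targets $\{\epsilon_k\}_{k\ge0}$, $\mathtt{fom}$, and $N_0\ge1$ (default $1$).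 Process $P_k$ runs $\mathtt{fom}(\epsilon_k)$ and stores a reference point; its task is to obtain a point $\overline x$ with $f(\overline x)\le f(\text{reference point of }P_k)-\epsilon_k$. Round $0$: set $\overline x^{(0)}=x^{(0)}$ and launch $P_0,\dots,P_{N_0-1}$, each with initial point and reference point $x^{(0)}$. Round $t=1,2,\dots$: (Step 1) every process currently in the scheme runs one iteration; let $\overline x^{(t)}$ be an iterate with minimum objective value among all new iterates of this round. (Step 2) For each process $P_k$ that was in the scheme at the beginning of round $t$: if $\overline x^{(t)}$ accomplishes the task of $P_k$, then $P_k$ is restarted at $\overline x^{(t)}$ (its memory is cleared, it then behaves as $\mathtt{fom}(\epsilon_k)$ started from $\overline x^{(t)}$, and its reference point becomes $\overline x^{(t)}$); if moreover $P_k$ is the highest-indexed process entering round $t$, a new process $P_{k+1}$ is launched with initial point and reference point $\overline x^{(t)}$ (its first iteration occurs in round $t+1$). Otherwise $P_k$ continues unchanged. *)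

theory Defs
  imports "HOL-Analysis.Analysis"
begin

section \<open>Objective function, growth condition, first-order method\<close>

text \<open>Used only for objectives that attain their minimum, so \<open>min_value f\<close> is a minimum.\<close>
definition min_value :: "('a \<Rightarrow> real) \<Rightarrow> real" where
  "min_value f = Inf (range f)"

definition minimizers :: "('a \<Rightarrow> real) \<Rightarrow> 'a set" where
  "minimizers f = {x. \<forall>y. f x \<le> f y}"

definition eta_optimal :: "('a \<Rightarrow> real) \<Rightarrow> real \<Rightarrow> 'a \<Rightarrow> bool" where
  "eta_optimal f \<eta> x \<longleftrightarrow> f x - min_value f \<le> \<eta>"

definition growth_condition ::
  "('a::metric_space \<Rightarrow> real) \<Rightarrow> (real \<Rightarrow> real) \<Rightarrow> 'a \<Rightarrow> bool" where
  "growth_condition f G x0 \<longleftrightarrow>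
     strict_mono_on {0..} G \<and> bij_betw G {0..} {0..} \<and>
     (\<forall>x. f x \<le> f x0 \<longrightarrow> f x - min_value f \<ge> G (infdist x (minimizers f)))"

text \<open>
  A deterministic iterative method is represented by its iterates:
  \<open>fom \<epsilon> x k\<close> is the \<open>k\<close>-th iterate of \<open>fom(\<epsilon>)\<close> started from \<open>x\<close>. An iterate may depend
  on the whole history since the start, as that history is a function of \<open>\<epsilon>\<close> and \<open>x\<close>.
\<close>
definition iterative_method :: "(real \<Rightarrow> 'a \<Rightarrow> nat \<Rightarrow> 'a) \<Rightarrow> bool" where
  "iterative_method fom \<longleftrightarrow> (\<forall>\<epsilon>>0. \<forall>x. fom \<epsilon> x 0 = x)"

text \<open>
  The values of \<open>Kdec \<epsilon> \<delta> D\<close> matter only for \<open>\<delta> \<ge> 2\<epsilon> > 0\<close> and \<open>D > 0\<close>; they need not be integers.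
\<close>
definition decrement_guarantee ::
  "('a::metric_space \<Rightarrow> real) \<Rightarrow> (real \<Rightarrow> 'a \<Rightarrow> nat \<Rightarrow> 'a) \<Rightarrow> (real \<Rightarrow> real \<Rightarrow> real \<Rightarrow> real) \<Rightarrow> bool" where
  "decrement_guarantee f fom Kdec \<longleftrightarrow>
     (\<forall>\<epsilon> \<delta> D. \<epsilon> > 0 \<and> \<delta> \<ge> 2 * \<epsilon> \<and> D > 0 \<longrightarrow>
        Kdec \<epsilon> \<delta> D \<ge> 0 \<and>
        (\<forall>x. f x - min_value f \<ge> \<delta> \<and> infdist x (minimizers f) \<le> D \<longrightarrow>
             (MIN k \<in> {k. real k \<le> Kdec \<epsilon> \<delta> D}. f (fom \<epsilon> x k)) \<le> f x - \<epsilon>))"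

definition Kdec_monotone :: "(real \<Rightarrow> real \<Rightarrow> real \<Rightarrow> real) \<Rightarrow> bool" where
  "Kdec_monotone Kdec \<longleftrightarrow>
     (\<forall>\<epsilon> \<delta> \<delta>' D. \<epsilon> > 0 \<and> 2 * \<epsilon> \<le> \<delta> \<and> \<delta> \<le> \<delta>' \<and> D > 0 \<longrightarrow> Kdec \<epsilon> \<delta>' D \<le> Kdec \<epsilon> \<delta> D) \<and>
     (\<forall>\<epsilon> \<delta> D D'. \<epsilon> > 0 \<and> 2 * \<epsilon> \<le> \<delta> \<and> 0 < D \<and> D \<le> D' \<longrightarrow> Kdec \<epsilon> \<delta> D \<le> Kdec \<epsilon> \<delta> D')"

section \<open>The dynamic restarting scheme\<close>

text \<open>
  The state after a round. The processes in the scheme are those with index \<open>k < num_procs\<close>;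
  no process is ever removed, so \<open>num_procs\<close> also counts the processes launched so far.
  The initial point of (the current run of) a process is its reference point \<open>ref_pt k\<close>, and
  \<open>age k\<close> is the number of iterations made since then. Values at \<open>k \<ge> num_procs\<close> are irrelevant.
\<close>
record 'a drs_state =
  num_procs :: nat
  ref_pt :: "nat \<Rightarrow> 'a"
  age :: "nat \<Rightarrow> nat"
  xbar :: 'a

definition drs_init :: "'a \<Rightarrow> nat \<Rightarrow> 'a drs_state \<Rightarrow> bool" where
  "drs_init x0 N0 \<sigma> \<longleftrightarrow>
     num_procs \<sigma> = N0 \<and> xbar \<sigma> = x0 \<and> (\<forall>k<N0. ref_pt \<sigma> k = x0 \<and> age \<sigma> k = 0)"

definition new_iterate ::
  "(real \<Rightarrow> 'a \<Rightarrow> nat \<Rightarrow> 'a) \<Rightarrow> (nat \<Rightarrow> real) \<Rightarrow> 'a drs_state \<Rightarrow> nat \<Rightarrow> 'a" where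
  "new_iterate fom eps \<sigma> k = fom (eps k) (ref_pt \<sigma> k) (Suc (age \<sigma> k))"

definition accomplishes ::
  "('a \<Rightarrow> real) \<Rightarrow> (nat \<Rightarrow> real) \<Rightarrow> 'a drs_state \<Rightarrow> 'a \<Rightarrow> nat \<Rightarrow> bool" where
  "accomplishes f eps \<sigma> x k \<longleftrightarrow> f x \<le> f (ref_pt \<sigma> k) - eps k"

text \<open>
  One round. It is a relation rather than a function because ties between new iterates of minimum
  objective value may be broken arbitrarily.
\<close>
definition drs_round ::
  "('a \<Rightarrow> real) \<Rightarrow> (real \<Rightarrow> 'a \<Rightarrow> nat \<Rightarrow> 'a) \<Rightarrow> (nat \<Rightarrow> real) \<Rightarrow> 'a drs_state \<Rightarrow> 'a drs_state \<Rightarrow> bool" where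
  "drs_round f fom eps \<sigma> \<sigma>' \<longleftrightarrow>
     is_arg_min f (\<lambda>x. x \<in> new_iterate fom eps \<sigma> ` {..<num_procs \<sigma>}) (xbar \<sigma>') \<and>
     (\<forall>k<num_procs \<sigma>.
        if accomplishes f eps \<sigma> (xbar \<sigma>') k
        then ref_pt \<sigma>' k = xbar \<sigma>' \<and> age \<sigma>' k = 0
        else ref_pt \<sigma>' k = ref_pt \<sigma> k \<and> age \<sigma>' k = Suc (age \<sigma> k)) \<and>
     (if accomplishes f eps \<sigma> (xbar \<sigma>') (num_procs \<sigma> - 1)
      then num_procs \<sigma>' = Suc (num_procs \<sigma>) \<and>
           ref_pt \<sigma>' (num_procs \<sigma>) = xbar \<sigma>' \<and> age \<sigma>' (num_procs \<sigma>) = 0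
      else num_procs \<sigma>' = num_procs \<sigma>)"

text \<open>\<open>\<sigma> t\<close> is the state after round \<open>t\<close>.\<close>
definition drs_run ::
  "('a \<Rightarrow> real) \<Rightarrow> (real \<Rightarrow> 'a \<Rightarrow> nat \<Rightarrow> 'a) \<Rightarrow> (nat \<Rightarrow> real) \<Rightarrow> nat \<Rightarrow> 'a \<Rightarrow> (nat \<Rightarrow> 'a drs_state) \<Rightarrow> bool" where
  "drs_run f fom eps N0 x0 \<sigma> \<longleftrightarrow>
     drs_init x0 N0 (\<sigma> 0) \<and> (\<forall>t. drs_round f fom eps (\<sigma> t) (\<sigma> (Suc t)))"

lemma drs_run_exists:
  assumes "N0 \<ge> 1"
  shows "\<exists>\<sigma>. drs_run f fom eps N0 x0 \<sigma>"
proof -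
  let ?P = "\<lambda>n \<sigma>. num_procs \<sigma> \<ge> 1 \<and> (n = 0 \<longrightarrow> drs_init x0 N0 \<sigma>)"
  have "\<exists>\<sigma>. ?P 0 \<sigma>"
    using assms by (intro exI[of _ "\<lparr>num_procs = N0, ref_pt = \<lambda>_. x0, age = \<lambda>_. 0, xbar = x0\<rparr>"])
      (simp add: drs_init_def)
  moreover have "\<exists>\<sigma>'. ?P (Suc n) \<sigma>' \<and> drs_round f fom eps \<sigma> \<sigma>'" if "?P n \<sigma>" for n \<sigma>
  proof -
    let ?I = "new_iterate fom eps \<sigma> ` {..<num_procs \<sigma>}"
    have "?I \<noteq> {}" using that by (auto simp: lessThan_empty_iff)
    then obtain x where x: "is_arg_min f (\<lambda>x. x \<in> ?I) x"
      using ex_is_arg_min_if_finite[of ?I f] by auto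
    let ?a = "accomplishes f eps \<sigma> x"
    define \<sigma>' where "\<sigma>' = \<lparr>
      num_procs = (if ?a (num_procs \<sigma> - 1) then Suc (num_procs \<sigma>) else num_procs \<sigma>),
      ref_pt = (\<lambda>k. if k < num_procs \<sigma> \<and> \<not> ?a k then ref_pt \<sigma> k else x),
      age = (\<lambda>k. if k < num_procs \<sigma> \<and> \<not> ?a k then Suc (age \<sigma> k) else 0),
      xbar = x\<rparr>"
    have "drs_round f fom eps \<sigma> \<sigma>'" "num_procs \<sigma>' \<ge> 1"
      using x that by (auto simp: drs_round_def \<sigma>'_def)
    then show ?thesis by blast
  qed
  ultimately obtain \<sigma> where "\<forall>n. ?P n (\<sigma> n) \<and> drs_round f fom eps (\<sigma> n) (\<sigma> (Suc n))"
    using dependent_nat_choice[of ?P "\<lambda>_. drs_round f fom eps"] by auto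
  then show ?thesis unfolding drs_run_def by blast
qed

section \<open>The quantities in the bound\<close>

text \<open>
  Maxima and suprema over the empty set are \<open>0\<close>. The sets of reals to which \<open>sup0\<close> is applied in
  the bound are bounded above: there \<open>2 * eps k \<le> \<delta>min\<close>, so monotonicity bounds the values by
  \<open>Kdec (eps k) \<delta>min (G\<^sup>-\<^sup>1 \<delta>max)\<close>.
\<close>
definition sup0 :: "real set \<Rightarrow> real" where
  "sup0 A = (if A = {} then 0 else Sup A)"

definition max0 :: "real set \<Rightarrow> real" where
  "max0 A = (if A = {} then 0 else Max A)"

definition Q ::
  "(real \<Rightarrow> real \<Rightarrow> real \<Rightarrow> real) \<Rightarrow> (real \<Rightarrow> real) \<Rightarrow> (nat \<Rightarrow> real) \<Rightarrow> nat \<Rightarrow> real \<Rightarrow> real \<Rightarrow> real" where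
  "Q Kdec G eps k \<delta>min \<delta>max =
     sup0 ((\<lambda>\<delta>. Kdec (eps k) \<delta> (the_inv_into {0..} G \<delta>)) ` {\<delta>min..\<delta>max})"

end

theory Submission
  imports Defs
begin

text \<open>
  Call the suboptimality of the reference point of \<open>P\<^sub>k\<close> its gap. An iterate of \<open>P\<^sub>k\<close> that achieves a
  decrement of \<open>\<epsilon>\<^sub>k\<close> forces a restart of \<open>P\<^sub>k\<close>, so the decrement guarantee bounds the rounds until
  the next restart as long as the gap is at least \<open>2\<epsilon>\<^sub>k\<close>, and every restart lowers the gap by at
  least \<open>\<epsilon>\<^sub>k\<close>. While the newest process has gap above \<open>2\<epsilon>\<^sub>k\<close>, its first restart launches the next
  process; this ends with a process \<open>P\<^sub>s\<close>, \<open>s \<le> m\<close>, whose gap is at most \<open>2\<epsilon>\<^sub>s\<close>. From there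
  the indices are descended: the gap of \<open>P\<^sub>k\<close> exceeds that of \<open>P\<^bsub>k+1\<^esub>\<close> by at most \<open>\<epsilon>\<^sub>k\<close>, because the
  reference point of \<open>P\<^bsub>k+1\<^esub>\<close> was offered to \<open>P\<^sub>k\<close>, and restarts of \<open>P\<^sub>k\<close> then bring its gap from at
  most \<open>2\<epsilon>\<^bsub>k+1\<^esub> + \<epsilon>\<^sub>k\<close> down to at most \<open>2\<epsilon>\<^sub>k\<close>.
\<close>

section \<open>Default-valued maxima and the minimum value\<close>

lemma max0_ge:
  assumes "finite A" "a \<in> A"
  shows "a \<le> max0 A"
  using assms by (auto simp: max0_def)

lemma max0_nonneg:
  assumes "finite A" "\<And>a. a \<in> A \<Longrightarrow> 0 \<le> a"
  shows "0 \<le> max0 A"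
  using assms Max_in[of A] by (auto simp: max0_def)

lemma min_value_le:
  assumes "minimizers f \<noteq> {}"
  shows "min_value f \<le> f x"
proof -
  have "bdd_below (range f)"
    using assms by (auto simp: minimizers_def bdd_below_def)
  then show ?thesis
    unfolding min_value_def by (rule cInf_lower[rotated]) simp
qed

text \<open>One arbitrary run \<open>\<sigma>\<close> is fixed, so the results hold however ties
  between best iterates are broken.\<close>

locale restarting_scheme =
  fixes f :: "'a::metric_space \<Rightarrow> real"
    and fom :: "real \<Rightarrow> 'a \<Rightarrow> nat \<Rightarrow> 'a"
    and Kdec :: "real \<Rightarrow> real \<Rightarrow> real \<Rightarrow> real"
    and G :: "real \<Rightarrow> real"
    and eps :: "nat \<Rightarrow> real"
    and N0 :: nat
    and x0 :: 'a
    and \<sigma> :: "nat \<Rightarrow> 'a drs_state"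
  assumes minimizers: "minimizers f \<noteq> {}"
    and iterative: "iterative_method fom"
    and decrement: "decrement_guarantee f fom Kdec"
    and Kdec_mono: "Kdec_monotone Kdec"
    and growth: "growth_condition f G x0"
    and eps_pos: "eps k > 0"
    and eps_mono: "strict_mono eps"
    and N0_pos: "N0 \<ge> 1"
    and run: "drs_run f fom eps N0 x0 \<sigma>"
begin

abbreviation procs :: "nat \<Rightarrow> nat" where
  "procs t \<equiv> num_procs (\<sigma> t)"

abbreviation gap :: "nat \<Rightarrow> nat \<Rightarrow> real" where
  "gap t k \<equiv> f (ref_pt (\<sigma> t) k) - min_value f"

abbreviation initial_gap :: real where
  "initial_gap \<equiv> f x0 - min_value f"

abbreviation restarts :: "nat \<Rightarrow> nat \<Rightarrow> bool" where
  "restarts t k \<equiv> accomplishes f eps (\<sigma> t) (xbar (\<sigma> (Suc t))) k"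

abbreviation Ginv :: "real \<Rightarrow> real" where
  "Ginv \<equiv> the_inv_into {0..} G"

subsection \<open>Invariants of the scheme\<close>

lemma init: "drs_init x0 N0 (\<sigma> 0)"
  and round: "drs_round f fom eps (\<sigma> t) (\<sigma> (Suc t))"
  using run by (auto simp: drs_run_def)

lemma restart_step:
  assumes "k < procs t" "restarts t k"
  shows "ref_pt (\<sigma> (Suc t)) k = xbar (\<sigma> (Suc t))" "age (\<sigma> (Suc t)) k = 0"
    "gap (Suc t) k \<le> gap t k - eps k"
  using round[of t] assms by (auto simp: drs_round_def accomplishes_def)

lemma continue_step:
  assumes "k < procs t" "\<not> restarts t k"
  shows "ref_pt (\<sigma> (Suc t)) k = ref_pt (\<sigma> t) k" "age (\<sigma> (Suc t)) k = Suc (age (\<sigma> t) k)"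
  using round[of t] assms by (auto simp: drs_round_def)

lemma launch_step:
  assumes "restarts t (procs t - 1)"
  shows "procs (Suc t) = Suc (procs t)"
    "ref_pt (\<sigma> (Suc t)) (procs t) = xbar (\<sigma> (Suc t))" "age (\<sigma> (Suc t)) (procs t) = 0"
  using round[of t] assms by (auto simp: drs_round_def)

lemma no_launch_step:
  assumes "\<not> restarts t (procs t - 1)"
  shows "procs (Suc t) = procs t"
  using round[of t] assms by (auto simp: drs_round_def)

lemma procs_step: "procs t \<le> procs (Suc t)"
  using launch_step(1)[of t] no_launch_step[of t] by fastforce

lemma procs_mono: "t \<le> t' \<Longrightarrow> procs t \<le> procs t'"
  by (rule lift_Suc_mono_le) (rule procs_step)

lemma procs_pos: "procs t \<ge> 1"
  using procs_mono[of 0 t] init N0_pos by (auto simp: drs_init_def)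

text \<open>The case split of the inductions over rounds: restart and launch set the reference point
  to the new \<open>xbar\<close>, continuing keeps it.\<close>

lemma process_step_cases:
  assumes "k < procs (Suc t)"
  obtains (restart) "k < procs t" "restarts t k"
    | (continue) "k < procs t" "\<not> restarts t k"
    | (launch) "k = procs t" "restarts t (procs t - 1)"
proof (cases "k < procs t")
  case True
  then show ?thesis using that by blast
next
  case False
  then have "procs (Suc t) \<noteq> procs t"
    using assms by simp
  then have "restarts t (procs t - 1)"
    using no_launch_step by blast
  then show ?thesis
    using launch_step(1)[of t] False assms that(3) by simp
qed

lemma gap_step: "k < procs t \<Longrightarrow> gap (Suc t) k \<le> gap t k"
  using restart_step(3)[of k t] continue_step(1)[of k t] eps_pos[of k]
  by (cases "restarts t k") auto

lemma launch_gap: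
  assumes "restarts t (procs t - 1)"
  shows "gap (Suc t) (procs t) \<le> gap t (procs t - 1) - eps (procs t - 1)"
  using launch_step(2)[OF assms] assms by (simp add: accomplishes_def)

text \<open>Keeps every reference point in the sublevel set of \<open>x0\<close>, where the growth
  condition applies.\<close>

lemma gap_le_initial: "k < procs t \<Longrightarrow> gap t k \<le> initial_gap"
proof (induction t arbitrary: k)
  case 0
  then show ?case using init by (simp add: drs_init_def)
next
  case (Suc t)
  from Suc.prems show ?case
  proof (cases rule: process_step_cases)
    case launch
    have "gap t (procs t - 1) \<le> initial_gap"
      using procs_pos[of t] by (intro Suc.IH) simp
    then show ?thesis
      using launch_gap[OF launch(2)] eps_pos[of "procs t - 1"] unfolding launch(1) by linarith
  qed (use gap_step[of k t] Suc.IH[of k] in linarith)+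
qed

lemma initial_gaps: "k < N0 \<Longrightarrow> gap 0 k = initial_gap"
  and initial_procs: "procs 0 = N0"
  using init by (auto simp: drs_init_def)

text \<open>An \<open>xbar\<close> better than the reference point by \<open>eps k\<close> restarts
  process \<open>k\<close>, after which the two coincide.\<close>

lemma xbar_not_much_better:
  assumes "k < procs (Suc t)"
  shows "gap (Suc t) k \<le> f (xbar (\<sigma> (Suc t))) - min_value f + eps k"
  using assms
proof (cases rule: process_step_cases)
  case restart
  then show ?thesis using restart_step(1)[of k t] eps_pos[of k] by simp
next
  case continue
  then show ?thesis using continue_step(1)[of k t] by (simp add: accomplishes_def)
next
  case launch
  then show ?thesis using launch_step(2)[of t] eps_pos[of k] by simp
qed

text \<open>When process \<open>k\<close> takes over \<open>xbar\<close>, process \<open>j\<close>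
  is compared with that same point; later the gap of \<open>j\<close> only falls while that of
  \<open>k\<close> stays. It remains to treat a launch of \<open>j\<close> after that
  moment.\<close>

lemma gap_le_gap_plus_eps:
  "j < procs t \<Longrightarrow> k < procs t \<Longrightarrow> gap t j \<le> gap t k + eps j"
proof (induction t arbitrary: j k)
  case 0
  then show ?case using initial_gaps initial_procs eps_pos[of j] by simp
next
  case (Suc t)
  have new: "gap (Suc t) j \<le> gap (Suc t) k + eps j"
    if "ref_pt (\<sigma> (Suc t)) k = xbar (\<sigma> (Suc t))"
    using xbar_not_much_better[OF Suc.prems(1)] that by simp
  from Suc.prems(2) show ?case
  proof (cases rule: process_step_cases)
    case restart
    then show ?thesis using new restart_step(1) by blast
  next
    case launch
    then show ?thesis using new launch_step(2) by blast
  next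
    case k: continue
    have eq: "gap (Suc t) k = gap t k"
      using continue_step(1)[OF k] by simp
    show ?thesis
    proof (cases "j < procs t")
      case True
      then show ?thesis
        using Suc.IH[OF True k(1)] gap_step[OF True] eq by linarith
    next
      case False
      with Suc.prems(1) have launch: "j = procs t" "restarts t (procs t - 1)"
        by (auto elim: process_step_cases)
      \<comment> \<open>The new process \<open>j\<close> starts at least \<open>eps top\<close>
        below process \<open>top\<close>, which cancels the error \<open>eps top\<close> of the
        induction hypothesis.\<close>
      define top where "top = procs t - 1"
      have "gap t top \<le> gap t k + eps top"
        using procs_pos[of t] k(1) by (intro Suc.IH) (auto simp: top_def)
      then show ?thesis
        using launch_gap[OF launch(2)] eq eps_pos[of j] unfolding launch(1) top_def by linarith
    qed
  qed
qed

text \<open>Since \<open>xbar\<close> is at least as good as every new iterate, an iterate reaching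
  the decrement forces a restart, which resets the age.\<close>

lemma iterates_no_decrement:
  "k < procs t \<Longrightarrow> i \<le> age (\<sigma> t) k \<Longrightarrow>
    f (fom (eps k) (ref_pt (\<sigma> t) k) i) > f (ref_pt (\<sigma> t) k) - eps k"
proof (induction t arbitrary: k i)
  case 0
  then show ?case
    using init iterative eps_pos by (auto simp: drs_init_def iterative_method_def)
next
  case (Suc t)
  have start: "?case" if "age (\<sigma> (Suc t)) k = 0"
    using Suc.prems(2) that iterative eps_pos by (simp add: iterative_method_def)
  from Suc.prems(1) show ?case
  proof (cases rule: process_step_cases)
    case restart
    then show ?thesis by (intro start restart_step(2))
  next
    case launch
    then show ?thesis using start launch_step(3)[of t] by simp
  next
    case continue
    note step = continue_step[OF continue]
    show ?thesis
    proof (cases "i \<le> age (\<sigma> t) k")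
      case True
      then show ?thesis using Suc.IH[OF continue(1)] step by simp
    next
      case False
      then have i: "i = Suc (age (\<sigma> t) k)"
        using Suc.prems(2) step by simp
      have "is_arg_min f (\<lambda>x. x \<in> new_iterate fom eps (\<sigma> t) ` {..<procs t}) (xbar (\<sigma> (Suc t)))"
        using round[of t] by (simp add: drs_round_def)
      then have "f (xbar (\<sigma> (Suc t))) \<le> f (new_iterate fom eps (\<sigma> t) k)"
        using continue(1) by (auto simp: is_arg_min_linorder)
      then show ?thesis
        using continue(2) step i by (simp add: accomplishes_def new_iterate_def)
    qed
  qed
qed

text \<open>Turns the final bound on a gap into one on an \<open>xbar\<close> of the same or an
  earlier round.\<close>

lemma ref_pt_is_xbar:
  "k < procs t \<Longrightarrow> \<exists>t'\<le>t. ref_pt (\<sigma> t) k = xbar (\<sigma> t')"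
proof (induction t arbitrary: k)
  case 0
  then show ?case using init by (auto simp: drs_init_def)
next
  case (Suc t)
  from Suc.prems show ?case
  proof (cases rule: process_step_cases)
    case restart
    then show ?thesis using restart_step(1)[of k t] by blast
  next
    case launch
    then show ?thesis using launch_step(2)[of t] by blast
  next
    case continue
    then show ?thesis using continue_step(1)[of k t] Suc.IH[of k] by (metis le_SucI)
  qed
qed

lemma continue_steps:
  assumes "k < procs t" "\<And>v. t \<le> v \<Longrightarrow> v < t + n \<Longrightarrow> \<not> restarts v k"
  shows "ref_pt (\<sigma> (t + n)) k = ref_pt (\<sigma> t) k \<and> age (\<sigma> (t + n)) k = age (\<sigma> t) k + n \<and>
    (procs t = Suc k \<longrightarrow> procs (t + n) = Suc k)"
  using assms(2)
proof (induction n)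
  case (Suc n)
  have k: "k < procs (t + n)"
    using assms(1) procs_mono[of t "t + n"] by simp
  have "\<not> restarts (t + n) k"
    using Suc.prems by simp
  then show ?case
    using Suc.IH Suc.prems continue_step[OF k] no_launch_step[of "t + n"] by auto
qed simp

subsection \<open>Time to the next restart\<close>

lemma Ginv_pos:
  assumes "\<delta> > 0"
  shows "Ginv \<delta> > 0" "G (Ginv \<delta>) = \<delta>"
proof -
  have bij: "bij_betw G {0..} {0..}" and mono: "strict_mono_on {0..} G"
    using growth by (auto simp: growth_condition_def)
  show G: "G (Ginv \<delta>) = \<delta>"
    using bij assms by (intro f_the_inv_into_f_bij_betw) auto
  have "Ginv \<delta> \<in> {0..}"
    using bij_betw_the_inv_into[OF bij] assms by (auto simp: bij_betw_def)
  \<comment> \<open>The preimage of 0 is 0, since a positive one would make \<open>G 0\<close>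
    negative.\<close>
  moreover have "G 0 = 0"
  proof -
    obtain z where z: "z \<ge> 0" "G z = 0"
      using bij by (metis atLeast_iff bij_betw_imp_surj_on imageE order.refl)
    have "G 0 \<ge> 0"
      using bij by (auto simp: bij_betw_def)
    then show ?thesis
      using z mono by (metis atLeast_iff less_eq_real_def linorder_not_less strict_mono_onD)
  qed
  ultimately show "Ginv \<delta> > 0"
    using G assms by (metis atLeast_iff less_eq_real_def less_irrefl)
qed

lemma Ginv_le:
  assumes "d \<ge> 0" "G d \<le> \<delta>" "\<delta> > 0"
  shows "d \<le> Ginv \<delta>"
proof (rule ccontr)
  assume "\<not> d \<le> Ginv \<delta>"
  then have "G (Ginv \<delta>) < G d"
    using growth assms(1) Ginv_pos(1)[OF assms(3)]
    by (auto simp: growth_condition_def intro: strict_mono_onD)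
  then show False
    using Ginv_pos(2)[OF assms(3)] assms(2) by simp
qed

lemma Ginv_mono:
  assumes "0 < \<delta>" "\<delta> \<le> \<delta>'"
  shows "Ginv \<delta> \<le> Ginv \<delta>'"
  by (rule Ginv_le) (use assms Ginv_pos[of \<delta>] in linarith)+

text \<open>The decrement guarantee is used with \<open>\<delta>\<close> the current gap and
  \<open>D\<close> its image under \<open>Ginv\<close>. State \<open>u\<close> precedes the first
  restart from \<open>t\<close> on, so its gap is unchanged; the restart itself happens in round
  \<open>Suc u\<close>.\<close>

lemma next_restart:
  assumes "k < procs t" "2 * eps k \<le> gap t k"
  obtains u where "t \<le> u" "real (Suc u) \<le> real t + Kdec (eps k) (gap t k) (Ginv (gap t k))"
    "k < procs u" "restarts u k" "gap u k = gap t k" "procs t = Suc k \<Longrightarrow> procs u = Suc k"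
proof -
  define x where "x = ref_pt (\<sigma> t) k"
  define K where "K = Kdec (eps k) (gap t k) (Ginv (gap t k))"
  have pos: "gap t k > 0"
    using assms(2) eps_pos[of k] by linarith
  have "f x \<le> f x0"
    using gap_le_initial[OF assms(1)] by (simp add: x_def)
  then have "G (infdist x (minimizers f)) \<le> gap t k"
    using growth by (auto simp: growth_condition_def x_def)
  then have "infdist x (minimizers f) \<le> Ginv (gap t k)"
    using pos by (intro Ginv_le) (auto simp: infdist_nonneg)
  then have K: "K \<ge> 0" "(MIN i \<in> {i. real i \<le> K}. f (fom (eps k) x i)) \<le> f x - eps k"
    using decrement assms(2) Ginv_pos(1)[OF pos] eps_pos[of k]
    unfolding decrement_guarantee_def K_def by (auto simp: x_def)
  have fin: "finite {i. real i \<le> K}"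
    by (rule finite_subset[of _ "{..nat \<lfloor>K\<rfloor>}"]) (auto simp: le_nat_floor)
  have "0 \<in> {i. real i \<le> K}"
    using K(1) by simp
  then have "(MIN i \<in> {i. real i \<le> K}. f (fom (eps k) x i)) \<in>
      (\<lambda>i. f (fom (eps k) x i)) ` {i. real i \<le> K}"
    using fin by (intro Min_in) blast+
  then obtain i where i: "real i \<le> K" "f (fom (eps k) x i) \<le> f x - eps k"
    using K(2) by auto
  \<comment> \<open>Iterations made before state \<open>t\<close> only help: after \<open>i\<close>
    rounds without a restart the age is at least \<open>i\<close>, so iterate \<open>i\<close> would
    lack the decrement.\<close>
  have "\<exists>v. t \<le> v \<and> v < t + i \<and> restarts v k"
  proof (rule ccontr)
    assume "\<nexists>v. t \<le> v \<and> v < t + i \<and> restarts v k"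
    then have "ref_pt (\<sigma> (t + i)) k = x" "age (\<sigma> (t + i)) k \<ge> i"
      using continue_steps[OF assms(1), of i] by (auto simp: x_def)
    then show False
      using iterates_no_decrement[of k "t + i" i] i assms(1) procs_mono[of t "t + i"] by simp
  qed
  then obtain v where v: "t \<le> v \<and> v < t + i \<and> restarts v k" and
    least: "\<And>w. w < v \<Longrightarrow> \<not> (t \<le> w \<and> w < t + i \<and> restarts w k)"
    using exists_least_iff[of "\<lambda>v. t \<le> v \<and> v < t + i \<and> restarts v k"] by blast
  have "\<not> restarts w k" if "t \<le> w" "w < t + (v - t)" for w
    using least[of w] v that by auto
  then have steps: "ref_pt (\<sigma> v) k = ref_pt (\<sigma> t) k" "procs t = Suc k \<Longrightarrow> procs v = Suc k"
    using continue_steps[OF assms(1), of "v - t"] v by auto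
  show ?thesis
  proof (rule that[of v])
    show "real (Suc v) \<le> real t + Kdec (eps k) (gap t k) (Ginv (gap t k))"
      using v i(1) unfolding K_def[symmetric] by linarith
    show "k < procs v"
      using assms(1) procs_mono[of t v] v by simp
  qed (use steps v in auto)
qed

lemma Kdec_nonneg: "2 * eps k \<le> \<delta> \<Longrightarrow> Kdec (eps k) \<delta> (Ginv \<delta>) \<ge> 0"
  using decrement Ginv_pos(1)[of \<delta>] eps_pos[of k]
  unfolding decrement_guarantee_def by (smt (verit))

text \<open>Monotonicity bounds all values by the one at the smallest \<open>\<delta>\<close> and
  the largest distance, so \<open>Sup\<close> is a genuine upper bound.\<close>

lemma Kdec_le_Q:
  assumes "2 * eps k \<le> \<delta>min" "\<delta>min \<le> \<delta>" "\<delta> \<le> \<delta>max"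
  shows "Kdec (eps k) \<delta> (Ginv \<delta>) \<le> Q Kdec G eps k \<delta>min \<delta>max"
proof -
  let ?A = "(\<lambda>\<delta>. Kdec (eps k) \<delta> (Ginv \<delta>)) ` {\<delta>min..\<delta>max}"
  have "Kdec (eps k) d (Ginv d) \<le> Kdec (eps k) \<delta>min (Ginv \<delta>max)" if "d \<in> {\<delta>min..\<delta>max}" for d
  proof -
    have d: "\<delta>min \<le> d" "d \<le> \<delta>max" "0 < d"
      using that assms(1) eps_pos[of k] by (auto simp: less_le_trans)
    have "Kdec (eps k) d (Ginv d) \<le> Kdec (eps k) \<delta>min (Ginv d)"
      using Kdec_mono d Ginv_pos(1)[OF d(3)] assms(1) eps_pos
      unfolding Kdec_monotone_def by simp
    also have "\<dots> \<le> Kdec (eps k) \<delta>min (Ginv \<delta>max)"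
      using Kdec_mono Ginv_mono[OF d(3,2)] Ginv_pos(1)[OF d(3)] assms(1) d(1) eps_pos
      unfolding Kdec_monotone_def by simp
    finally show ?thesis .
  qed
  then have "bdd_above ?A"
    by (intro bdd_aboveI2)
  then have "Kdec (eps k) \<delta> (Ginv \<delta>) \<le> Sup ?A"
    using assms by (intro cSup_upper) auto
  then show ?thesis
    using assms by (simp add: Q_def sup0_def)
qed

lemma Q_nonneg:
  assumes "2 * eps k \<le> \<delta>min"
  shows "0 \<le> Q Kdec G eps k \<delta>min \<delta>max"
proof (cases "\<delta>min \<le> \<delta>max")
  case True
  then show ?thesis
    using Kdec_le_Q[OF assms order.refl True] Kdec_nonneg[OF assms] by linarith
qed (simp add: Q_def sup0_def)

subsection \<open>Launching processes until the newest gap is small\<close>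

text \<open>\<open>a\<close> is the newest process, \<open>U\<close> bounds its gap, and launching
  stops at process \<open>s\<close>. Free \<open>a\<close> and \<open>U\<close> let the induction
  pass to \<open>Suc a\<close> and \<open>U - eps a\<close>.\<close>

abbreviation launch_time :: "nat \<Rightarrow> real \<Rightarrow> nat \<Rightarrow> real" where
  "launch_time a U s \<equiv> \<Sum>k = a..<s.
     Q Kdec G eps k (eps (s - 1) + (\<Sum>j = k..<s. eps j)) (U - (\<Sum>j = a..<k. eps j))"

lemma two_eps_le_launch:
  assumes "k < s"
  shows "2 * eps k \<le> eps (s - 1) + (\<Sum>j = k..<s. eps j)"
proof -
  have "eps k \<le> eps (s - 1)"
    using eps_mono assms by (simp add: strict_mono_less_eq)
  moreover have "eps k \<le> (\<Sum>j = k..<s. eps j)"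
    using assms by (intro member_le_sum) (auto simp: eps_pos less_imp_le)
  ultimately show ?thesis by simp
qed

lemma launch_time_nonneg: "0 \<le> launch_time a U s"
  by (intro sum_nonneg Q_nonneg two_eps_le_launch) auto

text \<open>The lower bound on \<open>gap t a\<close> supplies the left ends of the intervals in
  \<open>Q\<close>: each launch costs at least \<open>eps j\<close>, and process
  \<open>s - 1\<close> had gap above \<open>2 * eps (s - 1)\<close> before its launch.\<close>

lemma launch_phase:
  assumes "initial_gap \<le> 2 * eps m" "procs t = Suc a" "gap t a \<le> U"
  shows "\<exists>s t'. a \<le> s \<and> s \<le> max a m \<and> s < procs t' \<and> gap t' s \<le> 2 * eps s \<and>
    (a < s \<longrightarrow> eps (s - 1) + (\<Sum>j = a..<s. eps j) \<le> gap t a) \<and>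
    real t' \<le> real t + launch_time a U s"
  using assms(2,3)
proof (induction "m - a" arbitrary: a t U rule: less_induct)
  case less
  show ?case
  proof (cases "gap t a \<le> 2 * eps a")
    case True
    then show ?thesis
      using less.prems by - (rule exI[of _ a], rule exI[of _ t], auto)
  next
    case False
    then have big: "2 * eps a \<le> gap t a" by simp
    have a: "a < procs t" using less.prems by simp
    \<comment> \<open>Only processes below \<open>m\<close> launch in this phase, so the induction
      measure drops.\<close>
    have "eps a < eps m"
      using False gap_le_initial[OF a] assms(1) by linarith
    then have am: "a < m"
      using eps_mono by (simp add: strict_mono_less)
    obtain u where u: "t \<le> u"
        "real (Suc u) \<le> real t + Kdec (eps a) (gap t a) (Ginv (gap t a))"
        "restarts u a" "gap u a = gap t a" "procs u = Suc a"
      using next_restart[OF a big] less.prems by metis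
    have top: "restarts u (procs u - 1)" using u by simp
    have new: "procs (Suc u) = Suc (Suc a)" "gap (Suc u) (Suc a) \<le> gap t a - eps a"
      using launch_step(1)[OF top] launch_gap[OF top] u by auto
    have "gap (Suc u) (Suc a) \<le> U - eps a"
      using new less.prems by linarith
    moreover have "m - Suc a < m - a"
      using am by simp
    ultimately obtain s t' where s: "Suc a \<le> s" "s \<le> max (Suc a) m" "s < procs t'"
        "gap t' s \<le> 2 * eps s"
        "Suc a < s \<longrightarrow> eps (s - 1) + (\<Sum>j = Suc a..<s. eps j) \<le> gap (Suc u) (Suc a)"
        "real t' \<le> real (Suc u) + launch_time (Suc a) (U - eps a) s"
      using less.hyps[OF _ new(1)] by blast
    have split: "(\<Sum>j = a..<k. eps j) = eps a + (\<Sum>j = Suc a..<k. eps j)" if "Suc a \<le> k" for k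
      using that by (simp add: sum.atLeast_Suc_lessThan)
    have low: "eps (s - 1) + (\<Sum>j = a..<s. eps j) \<le> gap t a"
    proof (cases "Suc a < s")
      case True
      then show ?thesis using s(5) new(2) split[OF s(1)] by linarith
    next
      case False
      then have "s = Suc a" using s(1) by simp
      \<comment> \<open>Here \<open>eps (s - 1)\<close> and the sum both equal
        \<open>eps a\<close>.\<close>
      then show ?thesis using big by simp
    qed
    have "launch_time a U s = Q Kdec G eps a (eps (s - 1) + (\<Sum>j = a..<s. eps j)) U +
        (\<Sum>k = Suc a..<s.
          Q Kdec G eps k (eps (s - 1) + (\<Sum>j = k..<s. eps j)) (U - (\<Sum>j = a..<k. eps j)))"
      using s(1) by (simp add: sum.atLeast_Suc_lessThan)
    also have "(\<Sum>k = Suc a..<s.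
          Q Kdec G eps k (eps (s - 1) + (\<Sum>j = k..<s. eps j)) (U - (\<Sum>j = a..<k. eps j))) =
        launch_time (Suc a) (U - eps a) s"
      by (intro sum.cong refl) (simp add: split algebra_simps)
    finally have "launch_time a U s = Q Kdec G eps a (eps (s - 1) + (\<Sum>j = a..<s. eps j)) U +
        launch_time (Suc a) (U - eps a) s" .
    moreover have "Kdec (eps a) (gap t a) (Ginv (gap t a)) \<le>
        Q Kdec G eps a (eps (s - 1) + (\<Sum>j = a..<s. eps j)) U"
      using s(1) low less.prems(2) by (intro Kdec_le_Q two_eps_le_launch) auto
    ultimately have "real t' \<le> real t + launch_time a U s"
      using s(6) u(2) by linarith
    then show ?thesis
      using s am low by - (rule exI[of _ s], rule exI[of _ t'], auto)
  qed
qed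

subsection \<open>Descending through the processes\<close>

text \<open>\<open>r\<close> counts restarts of process \<open>k\<close>. Before restart
  \<open>i\<close>, counted from 0, the gap is at least \<open>(r + 1 - i) * eps k\<close> and at
  most \<open>U - i * eps k\<close>.\<close>

abbreviation descent_time :: "nat \<Rightarrow> real \<Rightarrow> nat \<Rightarrow> real" where
  "descent_time k U r \<equiv> \<Sum>i<r.
     Q Kdec G eps k ((real r + 1 - real i) * eps k) (min (U - real i * eps k) initial_gap)"

lemma two_eps_le_descent: "i < r \<Longrightarrow> 2 * eps k \<le> (real r + 1 - real i) * eps k"
  using eps_pos[of k] by (intro mult_right_mono) (auto simp: less_imp_le)

lemma descent_time_nonneg: "0 \<le> descent_time k U r"
  by (intro sum_nonneg Q_nonneg two_eps_le_descent) auto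

text \<open>Every restart lowers the gap by at least \<open>eps k\<close>, and the gap before the
  last one still exceeds \<open>2 * eps k\<close>; hence the strict lower bound on the first
  gap.\<close>

lemma descent_one_process:
  assumes "k < procs t" "gap t k \<le> U"
  shows "\<exists>r t'. t \<le> t' \<and> gap t' k \<le> 2 * eps k \<and> (r > 0 \<longrightarrow> (real r + 1) * eps k < gap t k) \<and>
    real t' \<le> real t + descent_time k U r"
proof -
  \<comment> \<open>An a priori bound on the number of restarts, for the induction.\<close>
  obtain n :: nat where "gap t k / eps k < real n"
    using reals_Archimedean2 by blast
  then have "gap t k \<le> real (n + 2) * eps k"
    using eps_pos[of k] by (simp add: field_simps)
  with assms show ?thesis
  proof (induction n arbitrary: t U)
    case 0
    then show ?case by - (rule exI[of _ 0], rule exI[of _ t], auto)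
  next
    case (Suc n)
    show ?case
    proof (cases "gap t k \<le> 2 * eps k")
      case True
      then show ?thesis by - (rule exI[of _ 0], rule exI[of _ t], auto)
    next
      case False
      then have big: "2 * eps k \<le> gap t k" by simp
      obtain u where u: "t \<le> u"
          "real (Suc u) \<le> real t + Kdec (eps k) (gap t k) (Ginv (gap t k))"
          "k < procs u" "restarts u k" "gap u k = gap t k"
        using next_restart[OF Suc.prems(1) big] by metis
      have new: "gap (Suc u) k \<le> gap t k - eps k"
        using restart_step(3)[OF u(3,4)] u(5) by simp
      have "k < procs (Suc u)"
        using u(3) procs_step[of u] by simp
      moreover have "gap (Suc u) k \<le> U - eps k"
        using new Suc.prems(2) by linarith
      moreover have "gap (Suc u) k \<le> real (n + 2) * eps k"
        using new Suc.prems(3) by (simp add: algebra_simps)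
      ultimately obtain r t' where r: "Suc u \<le> t'" "gap t' k \<le> 2 * eps k"
          "r > 0 \<longrightarrow> (real r + 1) * eps k < gap (Suc u) k"
          "real t' \<le> real (Suc u) + descent_time k (U - eps k) r"
        using Suc.IH[of "Suc u" "U - eps k"] by blast
      have low: "(real (Suc r) + 1) * eps k < gap t k"
      proof (cases "r > 0")
        case True
        then show ?thesis using r(3) new by (simp add: algebra_simps)
      next
        case False
        then show ?thesis using \<open>\<not> gap t k \<le> 2 * eps k\<close> by simp
      qed
      \<comment> \<open>Splitting off the first restart shifts \<open>i\<close> by one, which turns
        \<open>U\<close> into \<open>U - eps k\<close>.\<close>
      have "descent_time k U (Suc r) =
          Q Kdec G eps k ((real (Suc r) + 1) * eps k) (min U initial_gap) +
          descent_time k (U - eps k) r"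
        unfolding sum.lessThan_Suc_shift by (simp add: algebra_simps)
      moreover have "Kdec (eps k) (gap t k) (Ginv (gap t k)) \<le>
          Q Kdec G eps k ((real (Suc r) + 1) * eps k) (min U initial_gap)"
        using two_eps_le_descent[of 0 "Suc r" k] low Suc.prems(2) gap_le_initial[OF Suc.prems(1)]
        by (intro Kdec_le_Q) auto
      ultimately have "real t' \<le> real t + descent_time k U (Suc r)"
        using r(4) u(2) by linarith
      then show ?thesis
        using r(1,2) u(1) low by - (rule exI[of _ "Suc r"], rule exI[of _ t'], auto)
    qed
  qed
qed

abbreviation stage_time :: "nat \<Rightarrow> real" where
  "stage_time k \<equiv> max0 ((\<lambda>r. \<Sum>i<r.
     Q Kdec G eps k ((real r + 1 - real i) * eps k)
       (min (2 * eps (k + 1) + (1 - real i) * eps k) initial_gap))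
     ` {r. 1 \<le> r \<and> real r < 2 * eps (k + 1) / eps k})"

text \<open>Identifies a summand of the final bound as the worst descent of process \<open>k\<close>
  from the gap left by process \<open>k + 1\<close>.\<close>

lemma stage_time_eq:
  "stage_time k = max0 (descent_time k (2 * eps (k + 1) + eps k)
     ` {r. 1 \<le> r \<and> real r < 2 * eps (k + 1) / eps k})"
  by (simp add: algebra_simps)

lemma finite_stage_range: "finite {r. 1 \<le> r \<and> real r < c}"
  by (rule finite_subset[of _ "{..nat \<lfloor>c\<rfloor>}"]) (auto simp: le_nat_floor)

lemma stage_time_nonneg: "0 \<le> stage_time k"
  unfolding stage_time_eq
  by (intro max0_nonneg finite_imageI finite_stage_range) (auto intro: descent_time_nonneg)

lemma descent_stage:
  assumes "k < procs t" "gap t k \<le> 2 * eps (k + 1) + eps k"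
  shows "\<exists>t'\<ge>t. gap t' k \<le> 2 * eps k \<and> real t' \<le> real t + stage_time k"
proof -
  let ?U = "2 * eps (k + 1) + eps k"
  obtain r t' where r: "t \<le> t'" "gap t' k \<le> 2 * eps k" "r > 0 \<longrightarrow> (real r + 1) * eps k < gap t k"
      "real t' \<le> real t + descent_time k ?U r"
    using descent_one_process[OF assms] by blast
  have "descent_time k ?U r \<le> stage_time k"
  proof (cases "r > 0")
    case True
    \<comment> \<open>Cancelling one \<open>eps k\<close> yields the strict upper limit for
      \<open>r\<close> in the maximum.\<close>
    then have "real r * eps k < 2 * eps (k + 1)"
      using r(3) assms(2) by (simp add: algebra_simps)
    then have "real r < 2 * eps (k + 1) / eps k"
      by (simp add: pos_less_divide_eq eps_pos)
    with True show ?thesis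
      unfolding stage_time_eq by (intro max0_ge finite_imageI finite_stage_range) auto
  next
    case False
    then show ?thesis using stage_time_nonneg by simp
  qed
  then show ?thesis
    using r by (intro exI[of _ t']) linarith
qed

lemma descent_phase:
  assumes "s < procs t" "gap t s \<le> 2 * eps s"
  shows "\<exists>t'. 0 < procs t' \<and> gap t' 0 \<le> 2 * eps 0 \<and> real t' \<le> real t + (\<Sum>k<s. stage_time k)"
  using assms
proof (induction s arbitrary: t)
  case 0
  then show ?case by auto
next
  case (Suc s)
  have s: "s < procs t" using Suc.prems by simp
  \<comment> \<open>Process \<open>s\<close> lags behind process \<open>s + 1\<close> by at most
    \<open>eps s\<close>.\<close>
  have "gap t s \<le> 2 * eps (s + 1) + eps s"
    using gap_le_gap_plus_eps[OF s Suc.prems(1)] Suc.prems(2) by simp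
  then obtain t1 where t1: "t1 \<ge> t" "gap t1 s \<le> 2 * eps s" "real t1 \<le> real t + stage_time s"
    using descent_stage[OF s] by blast
  have "s < procs t1"
    using s procs_mono[OF t1(1)] by simp
  from Suc.IH[OF this t1(2)] obtain t' where t': "0 < procs t'" "gap t' 0 \<le> 2 * eps 0"
      "real t' \<le> real t1 + (\<Sum>k<s. stage_time k)"
    by blast
  have "real t' \<le> real t + (\<Sum>k<Suc s. stage_time k)"
    unfolding sum.lessThan_Suc using t'(3) t1(3) by linarith
  with t' show ?case by blast
qed

section \<open>Combining the two phases and counting launches\<close>

lemma optimal_in_time:
  assumes m: "initial_gap \<le> 2 * eps m"
  shows "\<exists>t. real t \<le> max0 (launch_time (N0 - 1) initial_gap ` {N0..m}) + (\<Sum>k<m. stage_time k) \<and>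
    eta_optimal f (2 * eps 0) (xbar (\<sigma> t))"
proof -
  let ?L = "max0 (launch_time (N0 - 1) initial_gap ` {N0..m})"
  have L: "0 \<le> ?L"
    by (rule max0_nonneg) (use launch_time_nonneg in blast)+
  have "\<exists>s t. s \<le> m \<and> s < procs t \<and> gap t s \<le> 2 * eps s \<and> real t \<le> ?L"
  proof (cases "N0 \<le> m")
    case True
    have "procs 0 = Suc (N0 - 1)" "gap 0 (N0 - 1) \<le> initial_gap"
      using initial_procs initial_gaps[of "N0 - 1"] N0_pos by auto
    from launch_phase[OF m this] obtain s t where s: "N0 - 1 \<le> s" "s \<le> max (N0 - 1) m"
        "s < procs t" "gap t s \<le> 2 * eps s" "real t \<le> launch_time (N0 - 1) initial_gap s"
      by auto
    have "launch_time (N0 - 1) initial_gap s \<le> ?L"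
    proof (cases "s = N0 - 1")
      case True
      \<comment> \<open>Without a launch the sum is empty; this \<open>s\<close> lies outside the
        range of the maximum.\<close>
      then show ?thesis using L by simp
    next
      case False
      then show ?thesis using s(1,2) True by (intro max0_ge) auto
    qed
    then show ?thesis
      using s True by - (rule exI[of _ s], rule exI[of _ t], simp add: max_def split: if_splits)
  next
    case False
    \<comment> \<open>Process \<open>m\<close> is present from round 0 with gap at most
      \<open>2 * eps m\<close>, so this phase takes no rounds.\<close>
    then show ?thesis
      using L m initial_procs initial_gaps[of m] by - (rule exI[of _ m], rule exI[of _ 0], auto)
  qed
  then obtain s t where s: "s \<le> m" "s < procs t" "gap t s \<le> 2 * eps s" "real t \<le> ?L"
    by blast
  from descent_phase[OF s(2,3)] obtain t1 where t1: "0 < procs t1" "gap t1 0 \<le> 2 * eps 0"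
      "real t1 \<le> real t + (\<Sum>k<s. stage_time k)"
    by blast
  obtain t2 where t2: "t2 \<le> t1" "ref_pt (\<sigma> t1) 0 = xbar (\<sigma> t2)"
    using ref_pt_is_xbar[OF t1(1)] by blast
  have "(\<Sum>k<s. stage_time k) \<le> (\<Sum>k<m. stage_time k)"
    by (intro sum_mono2 stage_time_nonneg) (use s(1) in auto)
  moreover have "real t2 \<le> real t1"
    using t2(1) by simp
  ultimately have "real t2 \<le> ?L + (\<Sum>k<m. stage_time k)"
    using t1(3) s(4) by linarith
  then show ?thesis
    using t1(2) t2(2) by (auto simp: eta_optimal_def)
qed

text \<open>A launch lowers a gap of at most \<open>initial_gap\<close> by \<open>eps top\<close> to
  a nonnegative value, so only processes below \<open>M\<close> launch and the new index is at most
  \<open>M\<close>.\<close>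

lemma procs_le:
  assumes "eps M > initial_gap"
  shows "procs t \<le> max (M + 1) N0"
proof (induction t)
  case 0
  then show ?case using initial_procs by simp
next
  case (Suc t)
  show ?case
  proof (cases "restarts t (procs t - 1)")
    case False
    then show ?thesis using Suc no_launch_step by simp
  next
    case True
    define top where "top = procs t - 1"
    have "0 \<le> gap (Suc t) (procs t)"
      using min_value_le[OF minimizers] by simp
    then have "eps top \<le> gap t top"
      using launch_gap[OF True] unfolding top_def by linarith
    also have "\<dots> \<le> initial_gap"
      using procs_pos[of t] by (intro gap_le_initial) (simp add: top_def)
    finally have "eps top < eps M"
      using assms by simp
    then have "top < M"
      using eps_mono by (simp add: strict_mono_less)
    then show ?thesis
      using launch_step(1)[OF True] by (simp add: top_def)
  qed
qed

end

theorem theorem3p1: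
  fixes f :: "real ^ 'd \<Rightarrow> real"
    and fom :: "real \<Rightarrow> real ^ 'd \<Rightarrow> nat \<Rightarrow> real ^ 'd"
    and Kdec :: "real \<Rightarrow> real \<Rightarrow> real \<Rightarrow> real"
    and G :: "real \<Rightarrow> real"
    and eps :: "nat \<Rightarrow> real"
    and N0 m mhat :: nat
    and x0 :: "real ^ 'd"
    and \<Delta>0 :: real
    and \<sigma> :: "nat \<Rightarrow> (real ^ 'd) drs_state"
  assumes "convex_on UNIV f"
    and "minimizers f \<noteq> {}"
    and "iterative_method fom"
    and "decrement_guarantee f fom Kdec"
    and "Kdec_monotone Kdec"
    and "growth_condition f G x0"
    and "\<And>k. eps k > 0"
    and "strict_mono eps"
    and "filterlim eps at_top sequentially"
    and "N0 \<ge> 1"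
    and "\<Delta>0 = f x0 - min_value f"
    and "m = Inf {k. eps k \<ge> \<Delta>0 / 2}"
    and "mhat = Inf {k. eps k > \<Delta>0}"
    and "drs_run f fom eps N0 x0 \<sigma>"
  shows "(\<exists>t. real t \<le>
             max0 ((\<lambda>s. \<Sum>k = N0 - 1..<s.
                        Q Kdec G eps k
                          (eps (s - 1) + (\<Sum>j = k..<s. eps j))
                          (\<Delta>0 - (\<Sum>j = N0 - 1..<k. eps j)))
                    ` {N0..m})
             + (\<Sum>k<m. max0 ((\<lambda>r. \<Sum>i<r.
                        Q Kdec G eps k
                          ((real r + 1 - real i) * eps k)
                          (min (2 * eps (k + 1) + (1 - real i) * eps k) \<Delta>0))
                    ` {r. 1 \<le> r \<and> real r < 2 * eps (k + 1) / eps k}))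
           \<and> eta_optimal f (2 * eps 0) (xbar (\<sigma> t)))
       \<and> (\<forall>t. num_procs (\<sigma> t) \<le> max (mhat + 1) N0)"
proof -
  interpret restarting_scheme f fom Kdec G eps N0 x0 \<sigma>
    using assms by unfold_locales auto
  \<comment> \<open>Makes both index sets nonempty, so that the infima \<open>m\<close> and
    \<open>mhat\<close> are attained.\<close>
  have large: "\<exists>k. eps k > c" for c
    using assms(9) by (metis eventually_False_sequentially eventually_mono filterlim_at_top_dense)
  have "{k. eps k \<ge> \<Delta>0 / 2} \<noteq> {}"
    using large[of "\<Delta>0 / 2"] by (auto intro: less_imp_le)
  from Inf_nat_def1[OF this] have m: "initial_gap \<le> 2 * eps m"
    using assms(11,12) by simp
  have "{k. eps k > \<Delta>0} \<noteq> {}"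
    using large[of "\<Delta>0"] by auto
  from Inf_nat_def1[OF this] have "eps mhat > initial_gap"
    using assms(11,13) by simp
  then show ?thesis
    using optimal_in_time[OF m] procs_le unfolding assms(11) by blast
qed

end
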